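(* Let $$\mathcal{S}_{\mathrm{ext}}=\{(x,y)\in\mathbb{R}_{>0}^2:\ F(x,y,\tau)>0\ \text{ for all }\tau\in(0,x)\},$$ with the explicit function $F$ given in the context. Then for every fixed $x>0$, the set of values of $y>0$ for which $(x,y)\in\mathcal{S}_{\mathrm{ext}}$ is bounded above.
   Context: For $(x,y)\in\mathbb{R}_{>0}^2$ and $\tau\in[0,x]$, the function $F$ is defined by $$F(x,y,\tau)=-A_4\tau^4+A_3\tau^3-A_2\tau^2+2\tau+\frac{x^2+2x}{3(y^2+2y)}\left(1-\Big(\frac{y^2+2y}{x^2+2x}(\tau^2+2\tau)+1\Big)^{3/2}\right),$$ where $$A_4=\frac{y^2+2x^2y+5x^2+4x}{x^2(x^2+6x+6)(y+2)},$$ $$A_3=\frac{(x^3+5x^2+6x-6)y^2+12x^3y+12x(2x^2-x-3)}{3x^2(x^2+6x+6)(y+2)},$$ $$A_2=\frac{-(x^2+5x+6)y^2+x(x^2-6x-6)y+2(x^3-6x^2-3x+6)}{x(x^2+6x+6)(y+2)}.$$ *)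

theory Defs
  imports Complex_Main
begin

definition A4 :: "real \<Rightarrow> real \<Rightarrow> real" where
  "A4 x y = (y^2 + 2 * x^2 * y + 5 * x^2 + 4 * x) / (x^2 * (x^2 + 6 * x + 6) * (y + 2))"

definition A3 :: "real \<Rightarrow> real \<Rightarrow> real" where
  "A3 x y = ((x^3 + 5 * x^2 + 6 * x - 6) * y^2 + 12 * x^3 * y + 12 * x * (2 * x^2 - x - 3))
     / (3 * x^2 * (x^2 + 6 * x + 6) * (y + 2))"

definition A2 :: "real \<Rightarrow> real \<Rightarrow> real" where
  "A2 x y = (- (x^2 + 5 * x + 6) * y^2 + x * (x^2 - 6 * x - 6) * y
       + 2 * (x^3 - 6 * x^2 - 3 * x + 6))
     / (x * (x^2 + 6 * x + 6) * (y + 2))"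

text \<open>The function is only meant for \<open>x, y > 0\<close> and \<open>0 \<le> \<tau> \<le> x\<close>. There all denominators
  are positive, and the base of the power is at least 1, so that \<open>powr\<close> is the usual real power.\<close>

definition F :: "real \<Rightarrow> real \<Rightarrow> real \<Rightarrow> real" where
  "F x y \<tau> = - A4 x y * \<tau>^4 + A3 x y * \<tau>^3 - A2 x y * \<tau>^2 + 2 * \<tau>
     + (x^2 + 2 * x) / (3 * (y^2 + 2 * y))
       * (1 - ((y^2 + 2 * y) / (x^2 + 2 * x) * (\<tau>^2 + 2 * \<tau>) + 1) powr (3 / 2))"

definition S_ext :: "(real \<times> real) set" where
  "S_ext = {(x, y). x > 0 \<and> y > 0 \<and> (\<forall>\<tau>\<in>{0<..<x}. F x y \<tau> > 0)}"

end

theory Submission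
  imports Defs
begin

text \<open>As \<open>y \<rightarrow> \<infinity>\<close> with \<open>x\<close> and \<open>\<tau>\<close> fixed, \<open>F x y \<tau>\<close> grows linearly in \<open>y\<close>.
  The polynomial part contributes at most a multiple of \<open>y * \<tau>\<^sup>2\<close> for \<open>\<tau> \<le> 1\<close>, while the
  power contributes at most a negative multiple of \<open>y * \<tau> powr (3/2)\<close>, up to terms bounded
  in \<open>y\<close>. For one small fixed \<open>\<tau>\<close> the latter wins, so \<open>F x y \<tau> < 0\<close> for all large \<open>y\<close>.
  Below \<open>\<tau> = u\<^sup>2\<close>, so that all half-integral powers become integral.\<close>

text \<open>Since \<open>y\<^sup>2 \<le> y * (y + 2)\<close>, one factor \<open>y + 2\<close>
  cancels. This fits \<open>A3\<close> and \<open>A2\<close>, whose denominators have the shape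
  \<open>d * (y + 2)\<close>.\<close>

lemma divide_linear_bound:
  fixes y d n N :: real
  assumes "y > 0" "d > 0" "N \<ge> 0" "n \<le> N * y\<^sup>2"
  shows "n / (d * (y + 2)) \<le> N / d * y"
proof -
  have "n \<le> N * y * (y + 2)"
    using assms by (smt (verit) distrib_left mult.assoc mult_nonneg_nonneg power2_eq_square)
  then have "n / (d * (y + 2)) \<le> N * y * (y + 2) / (d * (y + 2))"
    using assms by (intro divide_right_mono) auto
  then show ?thesis
    using assms by simp
qed

lemma A4_nonneg:
  assumes "x > 0" "y > 0"
  shows "A4 x y \<ge> 0"
  unfolding A4_def using assms by (intro divide_nonneg_nonneg) auto

lemma A3_linear_bound:
  assumes "x > 0" "y \<ge> 1"
  shows "A3 x y \<le> (37 * x^3 + 5 * x\<^sup>2 + 6 * x) / (3 * x\<^sup>2 * (x\<^sup>2 + 6 * x + 6)) * y"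
proof -
  have y2: "1 \<le> y\<^sup>2" "y \<le> y\<^sup>2"
    using assms self_le_power[of y 2] by auto
  have "x^3 * y \<le> x^3 * y\<^sup>2" "x^3 * 1 \<le> x^3 * y\<^sup>2"
    using assms y2 by (auto intro!: mult_left_mono simp del: mult_1_right)
  \<comment> \<open>The coefficient 37 is 1 + 12 + 24: \<open>y\<close> and 1 are replaced by
    \<open>y\<^sup>2\<close> in the positive terms, and the negative terms are dropped.\<close>
  then have "0 \<le> 12 * (x^3 * y\<^sup>2 - x^3 * y) + 24 * (x^3 * y\<^sup>2 - x^3 * 1)
      + 6 * y\<^sup>2 + 12 * x\<^sup>2 + 36 * x"
    by (intro add_nonneg_nonneg mult_nonneg_nonneg) (use assms in \<open>simp_all only: diff_ge_0_iff_ge\<close>, simp_all)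
  also have "\<dots> = (37 * x^3 + 5 * x\<^sup>2 + 6 * x) * y\<^sup>2
      - ((x^3 + 5 * x\<^sup>2 + 6 * x - 6) * y\<^sup>2 + 12 * x^3 * y + 12 * x * (2 * x\<^sup>2 - x - 3))"
    by (simp add: algebra_simps power2_eq_square power3_eq_cube)
  finally have "(x^3 + 5 * x\<^sup>2 + 6 * x - 6) * y\<^sup>2 + 12 * x^3 * y + 12 * x * (2 * x\<^sup>2 - x - 3)
      \<le> (37 * x^3 + 5 * x\<^sup>2 + 6 * x) * y\<^sup>2"
    by simp
  then show ?thesis
    unfolding A3_def using assms by (intro divide_linear_bound) (auto intro!: mult_pos_pos add_pos_pos)
qed

lemma minus_A2_linear_bound:
  assumes "x > 0" "y \<ge> 1"
  shows "- A2 x y \<le> (19 * x\<^sup>2 + 17 * x + 6) / (x * (x\<^sup>2 + 6 * x + 6)) * y"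
proof -
  have y2: "1 \<le> y\<^sup>2" "y \<le> y\<^sup>2"
    using assms self_le_power[of y 2] by auto
  have "x\<^sup>2 * y \<le> x\<^sup>2 * y\<^sup>2" "x * y \<le> x * y\<^sup>2" "x\<^sup>2 * 1 \<le> x\<^sup>2 * y\<^sup>2" "x * 1 \<le> x * y\<^sup>2"
    "0 \<le> x^3 * y" "0 \<le> x^3"
    using assms y2 by (auto intro!: mult_left_mono)
  \<comment> \<open>By the same replacement, 19 = 1 + 6 + 12 and 17 = 5 + 6 + 6.\<close>
  then have "- (- (x\<^sup>2 + 5 * x + 6) * y\<^sup>2 + x * (x\<^sup>2 - 6 * x - 6) * y
       + 2 * (x^3 - 6 * x\<^sup>2 - 3 * x + 6)) \<le> (19 * x\<^sup>2 + 17 * x + 6) * y\<^sup>2"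
    by (simp add: algebra_simps power2_eq_square power3_eq_cube)
  then show ?thesis
    unfolding A2_def minus_divide_left using assms
    by (intro divide_linear_bound) (auto intro!: mult_pos_pos add_pos_pos)
qed

text \<open>Dropping the summand 1 and replacing \<open>t\<close> by \<open>u\<^sup>2\<close> turns
  the power into the cube of \<open>sqrt p * u / sqrt q\<close>. The prefactor leaves one factor
  \<open>sqrt p\<close>, which is at least \<open>y\<close>.\<close>

lemma power_term_bound:
  fixes p q y u t :: real
  assumes "q > 0" "y \<ge> 1" "y\<^sup>2 \<le> p" "u > 0" "u\<^sup>2 \<le> t"
  shows "q / (3 * p) * (1 - (p / q * t + 1) powr (3 / 2)) \<le> q - y * u^3 / (3 * sqrt q)"
proof -
  define r s where "r = sqrt p" and "s = sqrt q"
  have "1 \<le> y\<^sup>2"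
    using assms by simp
  then have p: "p \<ge> 1"
    using assms by linarith
  have rs: "p = r\<^sup>2" "q = s\<^sup>2" "s > 0" "r > 0"
    using assms p by (auto simp: r_def s_def)
  have "y \<le> r"
    using assms by (auto simp: r_def intro: real_le_rsqrt)
  have "(r * u / s)^3 = ((r * u / s)\<^sup>2) powr (3 / 2)"
    using rs assms
    by (simp add: powr_powr flip: powr_numeral)
  also have "\<dots> \<le> (p / q * t + 1) powr (3 / 2)"
  proof (rule powr_mono2)
    have "p / q * u\<^sup>2 \<le> p / q * t"
      using assms p by (intro mult_left_mono) auto
    then show "(r * u / s)\<^sup>2 \<le> p / q * t + 1"
      by (simp add: rs power_mult_distrib power_divide)
  qed auto
  finally have "q / (3 * p) * (1 - (p / q * t + 1) powr (3 / 2)) \<le> q / (3 * p) * (1 - (r * u / s)^3)"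
    using assms p by (intro mult_left_mono) auto
  also have "\<dots> = q / (3 * p) - r * u^3 / (3 * s)"
    using rs(3,4) unfolding rs(1,2) by (simp add: field_simps power2_eq_square power3_eq_cube)
  also have "\<dots> \<le> q - y * u^3 / (3 * s)"
  proof (rule diff_mono)
    have "q * 1 \<le> q * (3 * p)"
      using assms p by (intro mult_left_mono) auto
    then show "q / (3 * p) \<le> q"
      using p by (simp add: divide_le_eq)
    show "y * u^3 / (3 * s) \<le> r * u^3 / (3 * s)"
      using \<open>y \<le> r\<close> assms rs by (intro divide_right_mono mult_right_mono) auto
  qed
  finally show ?thesis
    by (simp add: s_def)
qed

theorem proposition1p4:
  fixes x :: real
  assumes "x > 0"
  shows "bdd_above {y. y > 0 \<and> (x, y) \<in> S_ext}"
proof -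
  define a where "a = (37 * x^3 + 5 * x\<^sup>2 + 6 * x) / (3 * x\<^sup>2 * (x\<^sup>2 + 6 * x + 6))"
  define b where "b = (19 * x\<^sup>2 + 17 * x + 6) / (x * (x\<^sup>2 + 6 * x + 6))"
  define q where "q = x\<^sup>2 + 2 * x"
  define c where "c = 1 / (3 * sqrt q)"
  have "a \<ge> 0" "b > 0" "q > 0"
    using assms by (auto simp: a_def b_def q_def intro!: divide_pos_pos mult_pos_pos add_pos_pos)
  then have "c > 0"
    by (simp add: c_def)
  \<comment> \<open>The first bound puts \<open>u\<^sup>2\<close> inside the interval from 0 to
    \<open>x\<close> and below 1. The second lets the polynomial part, of size
    \<open>(a + b) * y * u^4\<close>, use up at most half of \<open>c * y * u^3\<close>.\<close>
  define u where "u = min (min 1 x / 2) (c / (2 * (a + b)))"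
  have "u \<le> min 1 x / 2" "u \<le> c / (2 * (a + b))" "u > 0"
    unfolding u_def by (rule min.cobounded1, rule min.cobounded2, use assms \<open>a \<ge> 0\<close> \<open>b > 0\<close> \<open>c > 0\<close> in simp)
  then have u: "u > 0" "u < 1" "u < x" "u \<le> c / (2 * (a + b))"
    using assms by auto
  have "u * u \<le> u * 1"
    using u by (intro mult_left_mono) auto
  then have u2: "u\<^sup>2 < x" "u\<^sup>2 \<le> 1" "u\<^sup>2 > 0"
    using u by (simp_all only: power2_eq_square mult_pos_pos)
  have uab: "(a + b) * u \<le> c / 2"
    using u(4) \<open>a \<ge> 0\<close> \<open>b > 0\<close> by (simp add: field_simps)
  \<comment> \<open>The 1 is there because the linear bounds assume \<open>y \<ge> 1\<close>; the
    other value is where the remaining half of the negative term balances the constant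
    \<open>2 + q\<close>.\<close>
  have "y \<le> max 1 ((2 + q) / (c / 2 * u^3))" if "(x, y) \<in> S_ext" for y
  proof (cases "y \<le> 1")
    case False
    then have y: "y \<ge> 1" by simp
    have "A3 x y * (u\<^sup>2)^3 \<le> (a * y) * (u\<^sup>2)^3"
      unfolding a_def by (rule mult_right_mono[OF A3_linear_bound]) (use assms y in auto)
    \<comment> \<open>As \<open>u\<^sup>2 \<le> 1\<close>, the cubic term can be merged with the
      quadratic one.\<close>
    also have "\<dots> \<le> (a * y) * (u\<^sup>2)\<^sup>2"
      using u2 \<open>a \<ge> 0\<close> y by (intro mult_left_mono power_decreasing) auto
    finally have 3: "A3 x y * (u\<^sup>2)^3 \<le> a * y * (u\<^sup>2)\<^sup>2" .
    have 2: "- A2 x y * (u\<^sup>2)\<^sup>2 \<le> (b * y) * (u\<^sup>2)\<^sup>2"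
      unfolding b_def by (rule mult_right_mono[OF minus_A2_linear_bound]) (use assms y in auto)
    have 4: "- A4 x y * (u\<^sup>2)^4 \<le> 0"
      using A4_nonneg[of x y] assms y by simp
    have pw: "q / (3 * (y\<^sup>2 + 2 * y))
        * (1 - ((y\<^sup>2 + 2 * y) / q * ((u\<^sup>2)\<^sup>2 + 2 * u\<^sup>2) + 1) powr (3 / 2)) \<le> q - c * y * u^3"
      using power_term_bound[of q y "y\<^sup>2 + 2 * y" u "(u\<^sup>2)\<^sup>2 + 2 * u\<^sup>2"] y u \<open>q > 0\<close>
      by (simp add: c_def)
    have "0 < F x y (u\<^sup>2)"
      using that u2 by (auto simp: S_ext_def)
    also have "\<dots> \<le> a * y * (u\<^sup>2)\<^sup>2 + b * y * (u\<^sup>2)\<^sup>2 + 2 + (q - c * y * u^3)"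
      using 2 3 4 pw u2 unfolding F_def q_def by linarith
    also have "\<dots> = ((a + b) * u) * (y * u^3) + 2 + q - c * y * u^3"
      by (simp add: algebra_simps power2_eq_square power3_eq_cube)
    also have "\<dots> \<le> (c / 2) * (y * u^3) + 2 + q - c * y * u^3"
      by (intro diff_right_mono add_right_mono mult_right_mono[OF uab]) (use y u in simp)
    finally have "y * (c / 2 * u^3) < 2 + q"
      by (simp add: algebra_simps)
    then have "y \<le> (2 + q) / (c / 2 * u^3)"
      using u \<open>c > 0\<close> by (simp add: field_simps)
    then show ?thesis by simp
  qed simp
  then show ?thesis
    by (intro bdd_aboveI) blast
qed

end
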